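(* Let $n\ge1$ and let $\alpha\in\Psi$. Then $dS_{n+1}(f_\alpha)$ is (i) a timelike hypersurface if and only if $\alpha(t)>|\alpha'(t)|$ for all $t\in\mathbb{R}$; (ii) a null hypersurface if and only if $\alpha(t)=re^{\epsilon t}$ for all $t$, for some $\epsilon\in\{1,-1\}$ and some constant $r>0$; (iii) a spacelike hypersurface if and only if $\alpha(t)<|\alpha'(t)|$ for all $t\in\mathbb{R}$.
   Context: $\mathbb{R}^{n+2}_1$ is $\mathbb{R}^{n+2}$ with metric $\eta=-dx^0\otimes dx^0+dx^1\otimes dx^1+\cdots+dx^{n+1}\otimes dx^{n+1}$. For a smooth function $f:(a,b)\to\mathbb{R}$ on an open interval (possibly unbounded), $dS_{n+1}(f)$ is the hypersurface $\{x\in\mathbb{R}^{n+2}_1 : x^0\in(a,b),\ -(x^0)^2+(x^1)^2+\cdots+(x^{n+1})^2=f(x^0)^2\}$ with the metric induced from $\eta$. $\Psi$ is the set of smooth functions $\alpha:\mathbb{R}\to\mathbb{R}$ with $\alpha(t)>0$ for all $t$ and such that $h(t):=\alpha(t)\sinh t$ has nonzero derivative for all $t$. For $\alpha\in\Psi$, $f_\alpha:=\alpha\circ h^{-1}$ on the open interval $h(\mathbb{R})$. A vector $v$ is timelike if $\eta(v,v)<0$, null if $\eta(v,v)=0$ and $v\ne0$, spacelike if $\eta(v,v)>0$. A hypersurface $\Sigma$ is called timelike (resp. null, spacelike) if for every $p\in\Sigma$ the normal to $T_p\Sigma$ is spacelike (resp. null, timelike); equivalently, the induced metric is Lorentzian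 (resp. degenerate, Riemannian) at every point. *)

theory Defs
  imports "HOL-Analysis.Analysis"
begin

text \<open>Smooth maps between normed spaces. The domain \<open>S\<close> is always meant to be open; \<open>C^(k+1)\<close> is
  differentiability with all directional derivatives of class \<open>C^k\<close>, which in finite dimension is
  the usual notion.\<close>

primrec Ck_on ::
  "nat \<Rightarrow> 'a::euclidean_space set \<Rightarrow> ('a \<Rightarrow> 'b::euclidean_space) \<Rightarrow> bool" where
  "Ck_on 0 S f \<longleftrightarrow> continuous_on S f"
| "Ck_on (Suc k) S f \<longleftrightarrow> (\<forall>x\<in>S. f differentiable (at x)) \<and>
     (\<forall>v. Ck_on k S (\<lambda>x. frechet_derivative f (at x) v))"

definition smooth_on :: "'a::euclidean_space set \<Rightarrow> ('a \<Rightarrow> 'b::euclidean_space) \<Rightarrow> bool" where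
  "smooth_on S f \<longleftrightarrow> (\<forall>k. Ck_on k S f)"

text \<open>A smooth embedded hypersurface, given locally as the regular zero set of a smooth function.\<close>

definition hypersurface :: "'a::euclidean_space set \<Rightarrow> bool" where
  "hypersurface S \<longleftrightarrow> (\<forall>p\<in>S. \<exists>U (F :: 'a \<Rightarrow> real). open U \<and> p \<in> U \<and> smooth_on U F \<and>
     S \<inter> U = {x \<in> U. F x = 0} \<and> (\<forall>x\<in>S \<inter> U. frechet_derivative F (at x) \<noteq> (\<lambda>v. 0)))"

definition tangent_space :: "'a::euclidean_space set \<Rightarrow> 'a \<Rightarrow> 'a set" where
  "tangent_space S p = {v. \<exists>e > 0. \<exists>c :: real \<Rightarrow> 'a. smooth_on {-e<..<e} c \<and>
     c ` {-e<..<e} \<subseteq> S \<and> c 0 = p \<and> (c has_vector_derivative v) (at 0)}"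

text \<open>The Minkowski space \<open>\<real>^(d+1)\<close>, \<open>d = CARD('d)\<close>, is split into the time coordinate \<open>x^0\<close> (first
  component) and the space coordinates \<open>(x^1, \<dots>, x^d)\<close> (second component).\<close>

type_synonym 'd minkowski = "real \<times> (real ^ 'd)"

definition eta :: "'d::finite minkowski \<Rightarrow> 'd minkowski \<Rightarrow> real" where
  "eta v w = - fst v * fst w + (\<Sum>i\<in>UNIV. snd v $ i * snd w $ i)"

definition timelike :: "'d::finite minkowski \<Rightarrow> bool" where
  "timelike v \<longleftrightarrow> eta v v < 0"

definition null :: "'d::finite minkowski \<Rightarrow> bool" where
  "null v \<longleftrightarrow> eta v v = 0 \<and> v \<noteq> 0"

definition spacelike :: "'d::finite minkowski \<Rightarrow> bool" where
  "spacelike v \<longleftrightarrow> eta v v > 0"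

definition normal_space :: "'d::finite minkowski set \<Rightarrow> 'd minkowski \<Rightarrow> 'd minkowski set" where
  "normal_space S p = {v. \<forall>w\<in>tangent_space S p. eta v w = 0}"

text \<open>For a hypersurface the normal space is a line (\<open>eta\<close> is nondegenerate), so quantifying over
  its nonzero elements is the same as speaking of the normal.\<close>

definition timelike_hypersurface :: "'d::finite minkowski set \<Rightarrow> bool" where
  "timelike_hypersurface S \<longleftrightarrow>
     hypersurface S \<and> (\<forall>p\<in>S. \<forall>v\<in>normal_space S p - {0}. spacelike v)"

definition null_hypersurface :: "'d::finite minkowski set \<Rightarrow> bool" where
  "null_hypersurface S \<longleftrightarrow>
     hypersurface S \<and> (\<forall>p\<in>S. \<forall>v\<in>normal_space S p - {0}. null v)"

definition spacelike_hypersurface :: "'d::finite minkowski set \<Rightarrow> bool" where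
  "spacelike_hypersurface S \<longleftrightarrow>
     hypersurface S \<and> (\<forall>p\<in>S. \<forall>v\<in>normal_space S p - {0}. timelike v)"

text \<open>\<open>dS I f\<close> is \<open>dS_(n+1)(f)\<close> for \<open>f\<close> defined on the open interval \<open>I\<close>; the values of \<open>f\<close> outside
  \<open>I\<close> play no role.\<close>

definition dS :: "real set \<Rightarrow> (real \<Rightarrow> real) \<Rightarrow> 'd::finite minkowski set" where
  "dS I f = {x. fst x \<in> I \<and> - (fst x)\<^sup>2 + (\<Sum>i\<in>UNIV. (snd x $ i)\<^sup>2) = (f (fst x))\<^sup>2}"

definition h_of :: "(real \<Rightarrow> real) \<Rightarrow> real \<Rightarrow> real" where
  "h_of \<alpha> t = \<alpha> t * sinh t"

definition Psi :: "(real \<Rightarrow> real) set" where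
  "Psi = {\<alpha>. smooth_on UNIV \<alpha> \<and> (\<forall>t. \<alpha> t > 0) \<and> (\<forall>t. deriv (h_of \<alpha>) t \<noteq> 0)}"

text \<open>For \<open>\<alpha> \<in> Psi\<close> the map \<open>h_of \<alpha>\<close> is injective, so on the open interval \<open>range (h_of \<alpha>)\<close> the
  function \<open>inv (h_of \<alpha>)\<close> is its inverse.\<close>

definition f_of :: "(real \<Rightarrow> real) \<Rightarrow> real \<Rightarrow> real" where
  "f_of \<alpha> = \<alpha> \<circ> inv (h_of \<alpha>)"

end

theory Submission
  imports Defs
begin

text \<open>
  Write \<open>h t = \<alpha> t * sinh t\<close> and \<open>r t = \<alpha> t * cosh t\<close>. Since \<open>cosh\<^sup>2 - sinh\<^sup>2 = 1\<close>, the equation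
  \<open>- x\<^sub>0\<^sup>2 + \<bar>y\<bar>\<^sup>2 = f(x\<^sub>0)\<^sup>2\<close> at \<open>x\<^sub>0 = h t\<close> says \<open>\<bar>y\<bar> = r t\<close>. So the hypersurface is the surface of
  revolution about the time axis of the profile curve \<open>(h, r)\<close>, and its normal at a point
  \<open>(h t, y)\<close> is spanned by \<open>(r t * r' t, h' t * y)\<close>. The profile curve is the image of \<open>(0, \<alpha> t)\<close>
  under the Lorentz boost of rapidity \<open>t\<close>, hence \<open>h'\<^sup>2 - r'\<^sup>2 = \<alpha>\<^sup>2 - \<alpha>'\<^sup>2\<close>, and the normal \<open>N\<close> has
  \<open>eta N N = r\<^sup>2 * (\<alpha>\<^sup>2 - \<alpha>'\<^sup>2)\<close>. Its sign at parameter \<open>t\<close> is the sign of \<open>\<alpha> t - \<bar>\<alpha>' t\<bar>\<close>, because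
  \<open>\<alpha> > 0\<close>; every \<open>t\<close> is the parameter of some point. This gives the three equivalences, the null
  case in the form \<open>\<alpha> = \<bar>\<alpha>'\<bar>\<close>. There \<open>\<alpha>'\<close> is continuous and never zero, so its sign \<open>\<epsilon>\<close> is constant
  and \<open>\<alpha>' = \<epsilon> * \<alpha>\<close>, whose positive solutions are the exponentials.

  The tangent space consists of velocities of smooth curves, so the normal line is found from two
  sides: differentiating the defining equation along an arbitrary curve shows that the vector above
  is normal (\<open>tangent_equation\<close>), while rotations and the profile curve supply enough tangent vectors
  to exclude any other direction (\<open>normal_space_\<Sigma>\<close>). Smoothness of the defining function reduces to
  that of the inverse of \<open>h\<close> (\<open>inverse_function_real\<close>), for which smoothness has to be closed
  under products, composition and reciprocals.
\<close>

section \<open>Calculus of smooth maps\<close>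

text \<open>The class \<open>C^k\<close> is defined through the total function \<open>frechet_derivative\<close>, which depends on the
  map near the point only; on an open set, values elsewhere therefore do not matter.\<close>

lemma Ck_on_cong:
  assumes "open S" "\<And>x. x \<in> S \<Longrightarrow> f x = g x" "Ck_on k S f"
  shows "Ck_on k S g"
  using assms(2,3)
proof (induction k arbitrary: f g)
  case 0
  then show ?case
    using continuous_on_cong[of S S f g] by simp
next
  case (Suc k)
  have der: "(g has_derivative frechet_derivative f (at x)) (at x)" if "x \<in> S" for x
  proof -
    have "(f has_derivative frechet_derivative f (at x)) (at x)"
      using Suc.prems(2) that by (simp flip: frechet_derivative_works)
    then show ?thesis
      using has_derivative_transform_within_open[OF _ assms(1) that] Suc.prems(1) by blast
  qed
  have "Ck_on k S (\<lambda>x. frechet_derivative g (at x) v)" for v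
  proof (rule Suc.IH)
    show "frechet_derivative f (at x) v = frechet_derivative g (at x) v" if "x \<in> S" for x
      using frechet_derivative_at[OF der[OF that]] by simp
    show "Ck_on k S (\<lambda>x. frechet_derivative f (at x) v)"
      using Suc.prems(2) by simp
  qed
  then show ?case
    using der by (auto simp: differentiable_def)
qed

text \<open>The practical introduction rule: any derivative that has been computed may replace
  \<open>frechet_derivative\<close>.\<close>

lemma Ck_on_SucI:
  assumes "open S" "\<And>x. x \<in> S \<Longrightarrow> (f has_derivative D x) (at x)"
    and "\<And>v. Ck_on k S (\<lambda>x. D x v)"
  shows "Ck_on (Suc k) S f"
proof -
  have "Ck_on k S (\<lambda>x. frechet_derivative f (at x) v)" for v
  proof (rule Ck_on_cong[OF assms(1) _ assms(3)])
    show "D x v = frechet_derivative f (at x) v" if "x \<in> S" for x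
      using frechet_derivative_at[OF assms(2)[OF that]] by simp
  qed
  then show ?thesis
    using assms(2) by (auto simp: differentiable_def)
qed

lemma Ck_on_SucD: "Ck_on (Suc k) S f \<Longrightarrow> Ck_on k S f"
proof (induction k arbitrary: f)
  case 0
  then show ?case
    by (simp add: continuous_at_imp_continuous_on differentiable_imp_continuous_within)
next
  case (Suc k)
  then show ?case by (metis Ck_on.simps(2))
qed

lemma Ck_on_subset: "Ck_on k S f \<Longrightarrow> T \<subseteq> S \<Longrightarrow> Ck_on k T f"
  by (induction k arbitrary: f) (auto intro: continuous_on_subset)

lemma Ck_on_has_derivative:
  "Ck_on (Suc k) S f \<Longrightarrow> x \<in> S \<Longrightarrow> (f has_derivative frechet_derivative f (at x)) (at x)"
  by (simp flip: frechet_derivative_works)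

lemma Ck_on_const:
  assumes "open S"
  shows "Ck_on k S (\<lambda>x. c)"
proof (induction k arbitrary: c)
  case (Suc k)
  show ?case
    by (rule Ck_on_SucI[OF assms, where D = "\<lambda>x v. 0"]) (auto intro: Suc)
qed simp

lemma Ck_on_linear:
  assumes "open S" "bounded_linear L" "Ck_on k S f"
  shows "Ck_on k S (\<lambda>x. L (f x))"
  using assms(3)
proof (induction k arbitrary: f)
  case 0
  then show ?case
    using bounded_linear.continuous_on[OF assms(2)] by simp
next
  case (Suc k)
  show ?case
  proof (rule Ck_on_SucI[OF assms(1)])
    show "((\<lambda>x. L (f x)) has_derivative (\<lambda>v. L (frechet_derivative f (at x) v))) (at x)"
      if "x \<in> S" for x
      using bounded_linear.has_derivative[OF assms(2) Ck_on_has_derivative[OF Suc.prems that]] .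
    show "Ck_on k S (\<lambda>x. L (frechet_derivative f (at x) v))" for v
      using Suc by simp
  qed
qed

lemma Ck_on_ident:
  assumes "open S"
  shows "Ck_on k S (\<lambda>x. x)"
proof (cases k)
  case (Suc j)
  show ?thesis unfolding Suc
    by (rule Ck_on_SucI[OF assms, where D = "\<lambda>x v. v"]) (auto intro: Ck_on_const assms)
qed (simp add: continuous_on_id)

lemma Ck_on_add:
  assumes "open S" "Ck_on k S f" "Ck_on k S g"
  shows "Ck_on k S (\<lambda>x. f x + g x)"
  using assms(2,3)
proof (induction k arbitrary: f g)
  case 0
  then show ?case by (simp add: continuous_on_add)
next
  case (Suc k)
  show ?case
  proof (rule Ck_on_SucI[OF assms(1)])
    show "((\<lambda>x. f x + g x) has_derivative
        (\<lambda>v. frechet_derivative f (at x) v + frechet_derivative g (at x) v)) (at x)"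
      if "x \<in> S" for x
      using Suc.prems[THEN Ck_on_has_derivative, OF that] by (rule has_derivative_add)
    show "Ck_on k S (\<lambda>x. frechet_derivative f (at x) v + frechet_derivative g (at x) v)" for v
      using Suc by simp
  qed
qed

lemma Ck_on_sum:
  assumes "open S" "finite A" "\<And>i. i \<in> A \<Longrightarrow> Ck_on k S (f i)"
  shows "Ck_on k S (\<lambda>x. \<Sum>i\<in>A. f i x)"
  using assms(2,3)
proof (induction A rule: finite_induct)
  case empty
  then show ?case by (simp add: Ck_on_const[OF assms(1)])
next
  case (insert a A)
  then show ?case by (simp add: Ck_on_add[OF assms(1)])
qed

lemma Ck_on_scaleR:
  assumes "open S" "Ck_on k S f" "Ck_on k S g"
  shows "Ck_on k S (\<lambda>x. f x *\<^sub>R g x)"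
  using assms(2,3)
proof (induction k arbitrary: f g)
  case 0
  then show ?case by (simp add: continuous_on_scaleR)
next
  case (Suc k)
  show ?case
  proof (rule Ck_on_SucI[OF assms(1)])
    show "((\<lambda>x. f x *\<^sub>R g x) has_derivative
        (\<lambda>v. f x *\<^sub>R frechet_derivative g (at x) v + frechet_derivative f (at x) v *\<^sub>R g x)) (at x)"
      if "x \<in> S" for x
      using Suc.prems[THEN Ck_on_has_derivative, OF that] by (rule has_derivative_scaleR)
    show "Ck_on k S (\<lambda>x. f x *\<^sub>R frechet_derivative g (at x) v
        + frechet_derivative f (at x) v *\<^sub>R g x)" for v
      using Suc.prems Suc.prems[THEN Ck_on_SucD]
      by (intro Ck_on_add[OF assms(1)] Suc.IH) simp_all
  qed
qed

lemma Ck_on_Pair: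
  assumes "open S" "Ck_on k S f" "Ck_on k S g"
  shows "Ck_on k S (\<lambda>x. (f x, g x))"
proof -
  have "Ck_on k S (\<lambda>x. (f x, 0) + (0, g x))"
    using assms
    by (intro Ck_on_add Ck_on_linear[where L = "\<lambda>y. (y, 0)"] Ck_on_linear[where L = "\<lambda>y. (0, y)"])
      (auto intro!: bounded_linear_intros)
  then show ?thesis by simp
qed

text \<open>Induction on the order works because the chain rule, expanded over a basis of the middle space,
  \<open>Dg (f x) (Df x v) = (\<Sum>b. (Df x v \<bullet> b) *\<^sub>R Dg (f x) b)\<close>, expresses a directional derivative
  of the composition through products of \<open>C^k\<close> functions and compositions with \<open>f\<close> of directional
  derivatives of \<open>g\<close>, to which the induction hypothesis applies.\<close>

lemma Ck_on_compose:
  assumes "open S" "Ck_on k S f" "Ck_on k T g" "f ` S \<subseteq> T"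
  shows "Ck_on k S (\<lambda>x. g (f x))"
  using assms(2,3)
proof (induction k arbitrary: g)
  case 0
  then show ?case
    using assms(4) continuous_on_compose2 by auto
next
  case (Suc k)
  let ?Df = "\<lambda>x. frechet_derivative f (at x)" and ?Dg = "\<lambda>y. frechet_derivative g (at y)"
  show ?case
  proof (rule Ck_on_SucI[OF assms(1)])
    fix x assume x: "x \<in> S"
    then have f: "(f has_derivative ?Df x) (at x)" and g: "(g has_derivative ?Dg (f x)) (at (f x))"
      using Suc.prems assms(4) Ck_on_has_derivative by blast+
    have lin: "linear (?Dg (f x))"
      using g has_derivative_linear by blast
    have "?Dg (f x) (?Df x v) = (\<Sum>b\<in>Basis. (?Df x v \<bullet> b) *\<^sub>R ?Dg (f x) b)" for v
      by (subst euclidean_representation[of "?Df x v", symmetric])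
        (simp add: linear_sum[OF lin] linear_scale[OF lin] del: euclidean_representation)
    with has_derivative_compose[OF f g]
    show "((\<lambda>x. g (f x)) has_derivative
        (\<lambda>v. \<Sum>b\<in>Basis. (?Df x v \<bullet> b) *\<^sub>R ?Dg (f x) b)) (at x)"
      by simp
  next
    fix v
    show "Ck_on k S (\<lambda>x. \<Sum>b\<in>Basis. (?Df x v \<bullet> b) *\<^sub>R ?Dg (f x) b)"
    proof (intro Ck_on_sum Ck_on_scaleR assms(1) finite_Basis)
      fix b :: 'b
      show "Ck_on k S (\<lambda>x. ?Df x v \<bullet> b)"
        using Suc.prems(1)
        by (intro Ck_on_linear[where L = "\<lambda>y. y \<bullet> b"] assms(1) bounded_linear_inner_left) simp
      show "Ck_on k S (\<lambda>x. ?Dg (f x) b)"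
        using Suc.IH[of "\<lambda>y. ?Dg y b"] Suc.prems Ck_on_SucD by auto
    qed
  qed
qed

lemma Ck_on_real_SucI:
  fixes f :: "real \<Rightarrow> 'b::euclidean_space"
  assumes "open S" "\<And>x. x \<in> S \<Longrightarrow> (f has_vector_derivative f' x) (at x)" "Ck_on k S f'"
  shows "Ck_on (Suc k) S f"
proof (rule Ck_on_SucI[OF assms(1)])
  show "(f has_derivative (\<lambda>v. v *\<^sub>R f' x)) (at x)" if "x \<in> S" for x
    using assms(2)[OF that] by (simp add: has_vector_derivative_def)
  show "Ck_on k S (\<lambda>x. v *\<^sub>R f' x)" for v
    by (intro Ck_on_scaleR Ck_on_const assms)
qed

lemma smooth_on_const: "open S \<Longrightarrow> smooth_on S (\<lambda>x. c)"
  and smooth_on_ident: "open S \<Longrightarrow> smooth_on S (\<lambda>x. x)"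
  and smooth_on_linear: "open S \<Longrightarrow> bounded_linear L \<Longrightarrow> smooth_on S f \<Longrightarrow> smooth_on S (\<lambda>x. L (f x))"
  and smooth_on_add: "open S \<Longrightarrow> smooth_on S f \<Longrightarrow> smooth_on S f2 \<Longrightarrow> smooth_on S (\<lambda>x. f x + f2 x)"
  and smooth_on_scaleR: "open S \<Longrightarrow> smooth_on S a \<Longrightarrow> smooth_on S f \<Longrightarrow> smooth_on S (\<lambda>x. a x *\<^sub>R f x)"
  and smooth_on_Pair: "open S \<Longrightarrow> smooth_on S f \<Longrightarrow> smooth_on S g \<Longrightarrow> smooth_on S (\<lambda>x. (f x, g x))"
  and smooth_on_compose:
    "open S \<Longrightarrow> smooth_on S f \<Longrightarrow> smooth_on T k \<Longrightarrow> f ` S \<subseteq> T \<Longrightarrow> smooth_on S (\<lambda>x. k (f x))"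
  by (simp_all add: smooth_on_def Ck_on_const Ck_on_ident Ck_on_linear Ck_on_add Ck_on_scaleR
      Ck_on_Pair Ck_on_compose[where T = T])

lemma smooth_on_mult:
  fixes f g :: "'a::euclidean_space \<Rightarrow> real"
  shows "open S \<Longrightarrow> smooth_on S f \<Longrightarrow> smooth_on S g \<Longrightarrow> smooth_on S (\<lambda>x. f x * g x)"
  using smooth_on_scaleR[of S f g] by simp

lemma smooth_on_inner:
  fixes f g :: "'a::euclidean_space \<Rightarrow> 'b::euclidean_space"
  assumes "open S" "smooth_on S f" "smooth_on S g"
  shows "smooth_on S (\<lambda>x. f x \<bullet> g x)"
proof -
  have "smooth_on S (\<lambda>x. (f x \<bullet> b) * (g x \<bullet> b))" for b
    by (intro smooth_on_mult smooth_on_linear[where L = "\<lambda>y. y \<bullet> b"] assms bounded_linear_inner_left)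
  then have "smooth_on S (\<lambda>x. \<Sum>b\<in>Basis. (f x \<bullet> b) * (g x \<bullet> b))"
    by (simp add: smooth_on_def Ck_on_sum[OF assms(1)])
  then show ?thesis
    by (simp add: euclidean_inner[symmetric])
qed

lemma smooth_on_uminus: "open S \<Longrightarrow> smooth_on S f \<Longrightarrow> smooth_on S (\<lambda>x. - f x)"
  by (rule smooth_on_linear[OF _ bounded_linear_minus[OF bounded_linear_ident]])

lemma smooth_on_subset: "smooth_on S f \<Longrightarrow> T \<subseteq> S \<Longrightarrow> smooth_on T f"
  by (auto simp: smooth_on_def intro: Ck_on_subset)

lemma smooth_on_deriv:
  fixes f :: "real \<Rightarrow> real"
  assumes "open S" "smooth_on S f"
  shows "\<And>x. x \<in> S \<Longrightarrow> (f has_real_derivative deriv f x) (at x)" and "smooth_on S (deriv f)"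
proof -
  have der: "(f has_derivative frechet_derivative f (at x)) (at x)" if "x \<in> S" for x
    using assms(2) Ck_on_has_derivative[of 0, OF _ that] unfolding smooth_on_def by blast
  then show real: "(f has_real_derivative deriv f x) (at x)" if "x \<in> S" for x
    using that by (metis DERIV_deriv_iff_real_differentiable differentiableI)
  have "frechet_derivative f (at x) 1 = deriv f x" if "x \<in> S" for x
    using frechet_derivative_at[OF real[OF that, unfolded has_field_derivative_def]]
    by (metis mult.right_neutral)
  moreover have "Ck_on k S (\<lambda>x. frechet_derivative f (at x) 1)" for k
    using assms(2) Ck_on.simps(2) unfolding smooth_on_def by blast
  ultimately have "Ck_on k S (deriv f)" for k
    by (rule Ck_on_cong[OF assms(1)])
  then show "smooth_on S (deriv f)"
    by (simp add: smooth_on_def)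
qed

lemma smooth_on_sinh_cosh:
  "smooth_on UNIV (sinh :: real \<Rightarrow> real)" "smooth_on UNIV (cosh :: real \<Rightarrow> real)"
proof -
  have "Ck_on k UNIV (sinh :: real \<Rightarrow> real) \<and> Ck_on k UNIV (cosh :: real \<Rightarrow> real)" for k
  proof (induction k)
    case 0
    show ?case by (auto intro!: continuous_intros)
  next
    case (Suc k)
    then show ?case
      by (intro conjI Ck_on_real_SucI[where f' = cosh] Ck_on_real_SucI[where f' = sinh])
        (auto intro!: derivative_eq_intros simp flip: has_real_derivative_iff_has_vector_derivative)
  qed
  then show "smooth_on UNIV (sinh :: real \<Rightarrow> real)" "smooth_on UNIV (cosh :: real \<Rightarrow> real)"
    by (auto simp: smooth_on_def)
qed

lemma smooth_on_sin_cos: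
  "smooth_on UNIV (sin :: real \<Rightarrow> real)" "smooth_on UNIV (cos :: real \<Rightarrow> real)"
proof -
  have "Ck_on k UNIV (sin :: real \<Rightarrow> real) \<and> Ck_on k UNIV (cos :: real \<Rightarrow> real)" for k
  proof (induction k)
    case 0
    show ?case by (auto intro!: continuous_intros)
  next
    case (Suc k)
    then have "Ck_on k UNIV (\<lambda>x :: real. (- 1) *\<^sub>R sin x)"
      by (intro Ck_on_scaleR Ck_on_const) auto
    with Suc show ?case
      by (intro conjI Ck_on_real_SucI[where f' = cos] Ck_on_real_SucI[where f' = "\<lambda>x. - sin x"])
        (auto intro!: derivative_eq_intros simp flip: has_real_derivative_iff_has_vector_derivative)
  qed
  then show "smooth_on UNIV (sin :: real \<Rightarrow> real)" "smooth_on UNIV (cos :: real \<Rightarrow> real)"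
    by (auto simp: smooth_on_def)
qed

lemma smooth_on_inverse: "smooth_on (- {0}) (inverse :: real \<Rightarrow> real)"
proof -
  have "Ck_on k (- {0}) (inverse :: real \<Rightarrow> real)" for k
  proof (induction k)
    case 0
    show ?case by (auto intro!: continuous_intros)
  next
    case (Suc k)
    then have "Ck_on k (- {0}) (\<lambda>x :: real. (- 1) *\<^sub>R (inverse x *\<^sub>R inverse x))"
      by (intro Ck_on_scaleR Ck_on_const) auto
    then show ?case
      by (intro Ck_on_real_SucI[where f' = "\<lambda>x. - (inverse x * inverse x)"])
        (auto intro!: derivative_eq_intros simp flip: has_real_derivative_iff_has_vector_derivative)
  qed
  then show ?thesis by (simp add: smooth_on_def)
qed

text \<open>A nowhere vanishing derivative makes \<open>h\<close> injective by Rolle's theorem. The formula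
  \<open>(h^-1)' = 1 / (h' \<circ> h^-1)\<close> then lifts \<open>C^k\<close> to \<open>C^(k+1)\<close>: if the inverse is of class
  \<open>C^k\<close>, so is the right-hand side.\<close>

lemma inverse_function_real:
  fixes h :: "real \<Rightarrow> real"
  assumes "smooth_on UNIV h" "\<And>t. deriv h t \<noteq> 0"
  shows "inj h" "open (range h)"
    and "\<And>t. (inv h has_real_derivative inverse (deriv h t)) (at (h t))"
    and "smooth_on (range h) (inv h)"
proof -
  have der: "(h has_real_derivative deriv h t) (at t)" for t
    using smooth_on_deriv(1)[OF _ assms(1)] by simp
  have cont: "continuous_on UNIV h"
    using der DERIV_isCont by (blast intro: continuous_at_imp_continuous_on)
  have ne: "h a \<noteq> h b" if ab: "a < b" for a b
  proof
    assume eq: "h a = h b"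
    have "h differentiable (at x)" for x
      using der real_differentiable_def by blast
    then obtain z where "(h has_real_derivative 0) (at z)"
      using Rolle[OF ab eq continuous_on_subset[OF cont subset_UNIV]] by blast
    then show False
      using DERIV_imp_deriv assms(2) by blast
  qed
  then show inj: "inj h"
    by (metis injI linorder_neqE_linordered_idom)
  show op: "open (range h)"
    using injective_into_1d_imp_open_map_UNIV[OF open_UNIV cont inj] by simp
  show der_inv: "(inv h has_real_derivative inverse (deriv h t)) (at (h t))" for t
    unfolding has_field_derivative_def
    using assms(2) inj
    by (intro has_derivative_inverse_strong[OF open_UNIV UNIV_I cont _
          der[unfolded has_field_derivative_def]]) (auto simp: fun_eq_iff)
  have "Ck_on k (range h) (inv h)" for k
  proof (induction k)
    case 0
    then show ?case
      using der_inv DERIV_isCont by (auto intro!: continuous_at_imp_continuous_on)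
  next
    case (Suc k)
    show ?case
    proof (rule Ck_on_real_SucI[OF op])
      show "(inv h has_vector_derivative inverse (deriv h (inv h x))) (at x)" if "x \<in> range h" for x
        using that der_inv inj by (auto simp flip: has_real_derivative_iff_has_vector_derivative)
      have "Ck_on k (range h) (\<lambda>x. deriv h (inv h x))"
        using smooth_on_deriv(2)[OF open_UNIV assms(1)]
        by (intro Ck_on_compose[OF op Suc, where T = UNIV]) (simp_all add: smooth_on_def)
      then show "Ck_on k (range h) (\<lambda>x. inverse (deriv h (inv h x)))"
        using smooth_on_inverse assms(2)
        by (intro Ck_on_compose[OF op, where g = inverse and T = "- {0}"])
          (simp_all add: smooth_on_def image_iff eq_commute[of 0])
    qed
  qed
  then show "smooth_on (range h) (inv h)"
    by (simp add: smooth_on_def)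
qed

section \<open>The hypersurface as a surface of revolution\<close>

lemma eta_inner: "eta v w = - fst v * fst w + snd v \<bullet> snd w"
  by (simp add: eta_def inner_vec_def)

locale psi_profile =
  fixes \<alpha> :: "real \<Rightarrow> real"
  assumes Psi: "\<alpha> \<in> Psi"
begin

abbreviation h :: "real \<Rightarrow> real" where "h \<equiv> h_of \<alpha>"

definition r :: "real \<Rightarrow> real" where "r t = \<alpha> t * cosh t"

abbreviation \<Sigma> :: "'d::finite minkowski set" where "\<Sigma> \<equiv> dS (range h) (f_of \<alpha>)"

lemma smooth_\<alpha>: "smooth_on UNIV \<alpha>" and \<alpha>_pos: "\<alpha> t > 0" and deriv_h_nonzero: "deriv h t \<noteq> 0"
  using Psi by (auto simp: Psi_def)

lemma r_pos: "r t > 0"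
  by (simp add: r_def \<alpha>_pos)

lemma deriv_\<alpha>: "(\<alpha> has_real_derivative deriv \<alpha> t) (at t)"
  using smooth_on_deriv(1)[OF open_UNIV smooth_\<alpha>] by simp

lemma smooth_h: "smooth_on UNIV h" and smooth_r: "smooth_on UNIV r"
  unfolding h_of_def[abs_def] r_def[abs_def]
  by (intro smooth_on_mult open_UNIV smooth_\<alpha> smooth_on_sinh_cosh)+

lemma has_deriv_h: "(h has_real_derivative deriv h t) (at t)"
  and has_deriv_r: "(r has_real_derivative deriv r t) (at t)"
  using smooth_on_deriv(1)[OF open_UNIV] smooth_h smooth_r by simp_all

lemma deriv_h: "deriv h t = deriv \<alpha> t * sinh t + \<alpha> t * cosh t"
  unfolding h_of_def[abs_def]
  by (rule DERIV_imp_deriv) (auto intro!: derivative_eq_intros deriv_\<alpha> simp: algebra_simps)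

lemma deriv_r: "deriv r t = deriv \<alpha> t * cosh t + \<alpha> t * sinh t"
  unfolding r_def[abs_def]
  by (rule DERIV_imp_deriv) (auto intro!: derivative_eq_intros deriv_\<alpha> simp: algebra_simps)

text \<open>In the boosted frame \<open>(cosh t, sinh t), (sinh t, cosh t)\<close>, which is orthonormal for the Minkowski
  form, the velocity of the profile curve \<open>(h, r)\<close> has components \<open>\<alpha> t\<close> and \<open>\<alpha>' t\<close>.\<close>

lemma deriv_h_r_squares: "(deriv h t)\<^sup>2 - (deriv r t)\<^sup>2 = (\<alpha> t)\<^sup>2 - (deriv \<alpha> t)\<^sup>2"
proof -
  have "(deriv h t)\<^sup>2 - (deriv r t)\<^sup>2 = ((\<alpha> t)\<^sup>2 - (deriv \<alpha> t)\<^sup>2) * ((cosh t)\<^sup>2 - (sinh t)\<^sup>2)"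
    unfolding deriv_h deriv_r by algebra
  then show ?thesis
    by (simp add: hyperbolic_pythagoras)
qed

lemmas h_inverse = inverse_function_real[OF smooth_h deriv_h_nonzero]

text \<open>The squared radius of the sphere cut out by the time slice \<open>x\<^sub>0 = x\<close>, for \<open>x\<close> in the range of \<open>h\<close>.\<close>

definition radius_sqr :: "real \<Rightarrow> real" where
  "radius_sqr x = (r (inv h x))\<^sup>2"

lemma radius_sqr_h [simp]: "radius_sqr (h t) = (r t)\<^sup>2"
  by (simp add: radius_sqr_def h_inverse(1))

lemma mem_\<Sigma>: "p \<in> \<Sigma> \<longleftrightarrow> fst p \<in> range h \<and> snd p \<bullet> snd p = radius_sqr (fst p)"
proof -
  have "(h t)\<^sup>2 + (f_of \<alpha> (h t))\<^sup>2 = radius_sqr (h t)" for t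
  proof -
    have "f_of \<alpha> (h t) = \<alpha> t"
      by (simp add: f_of_def h_inverse(1))
    moreover have "(\<alpha> t * sinh t)\<^sup>2 + (\<alpha> t)\<^sup>2 = (\<alpha> t * cosh t)\<^sup>2"
      using hyperbolic_pythagoras[of t] by algebra
    ultimately show ?thesis
      unfolding radius_sqr_h by (simp add: r_def h_of_def)
  qed
  then have "- (fst p)\<^sup>2 + s = (f_of \<alpha> (fst p))\<^sup>2 \<longleftrightarrow> s = radius_sqr (fst p)"
    if "fst p \<in> range h" for s
    using that by (smt (verit) imageE)
  then show ?thesis
    by (auto simp: dS_def inner_vec_def power2_eq_square)
qed

lemma smooth_radius_sqr: "smooth_on (range h) radius_sqr"
proof -
  have "smooth_on (range h) (\<lambda>x. r (inv h x))"
    by (rule smooth_on_compose[OF h_inverse(2,4) smooth_r]) simp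
  then have "smooth_on (range h) (\<lambda>x. r (inv h x) * r (inv h x))"
    by (intro smooth_on_mult h_inverse(2))
  then show ?thesis
    by (simp add: radius_sqr_def[abs_def] power2_eq_square)
qed

lemma has_deriv_radius_sqr:
  "(radius_sqr has_real_derivative 2 * r t * deriv r t / deriv h t) (at (h t))"
proof -
  have "((\<lambda>x. r (inv h x)) has_real_derivative deriv r t * inverse (deriv h t)) (at (h t))"
    by (rule DERIV_chain2[OF _ h_inverse(3)]) (simp add: h_inverse(1) has_deriv_r)
  then have "((\<lambda>x. (r (inv h x))\<^sup>2) has_real_derivative
      2 * r t * (deriv r t * inverse (deriv h t))) (at (h t))"
    by (auto intro!: derivative_eq_intros simp: h_inverse(1))
  then show ?thesis
    by (simp add: radius_sqr_def[abs_def] field_simps)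
qed

text \<open>One defining function \<open>F x = \<bar>snd x\<bar>\<^sup>2 - radius_sqr (fst x)\<close> serves near all points. It is regular
  because its derivative in the radial direction is \<open>2 * r\<^sup>2 > 0\<close>.\<close>

lemma hypersurface_\<Sigma>: "hypersurface (\<Sigma> :: 'd::finite minkowski set)"
  unfolding hypersurface_def
proof
  fix p :: "'d minkowski"
  assume p: "p \<in> \<Sigma>"
  define U :: "'d minkowski set" where "U = fst -` range h"
  define F :: "'d minkowski \<Rightarrow> real" where "F x = snd x \<bullet> snd x - radius_sqr (fst x)" for x
  have "open U"
    unfolding U_def by (intro open_vimage_fst h_inverse(2))
  have fst: "smooth_on U fst" and snd: "smooth_on U snd"
    using smooth_on_linear[OF \<open>open U\<close> _ smooth_on_ident[OF \<open>open U\<close>]]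
      bounded_linear_fst bounded_linear_snd by blast+
  have "smooth_on U (\<lambda>x. radius_sqr (fst x))"
    by (rule smooth_on_compose[OF \<open>open U\<close> fst smooth_radius_sqr]) (auto simp: U_def)
  then have "smooth_on U (\<lambda>x. snd x \<bullet> snd x + - radius_sqr (fst x))"
    by (intro smooth_on_add smooth_on_uminus smooth_on_inner snd \<open>open U\<close>)
  then have F: "smooth_on U F"
    by (simp add: F_def[abs_def])
  have "frechet_derivative F (at x) \<noteq> (\<lambda>v. 0)" if x: "x \<in> \<Sigma> \<inter> U" for x
  proof -
    obtain t where t: "fst x = h t" and n: "snd x \<bullet> snd x = (r t)\<^sup>2"
      using x by (auto simp: mem_\<Sigma>)
    let ?g = "2 * r t * deriv r t / deriv h t"
    have "((\<lambda>x. radius_sqr (fst x)) has_derivative (\<lambda>v. ?g * fst v)) (at x)"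
      using has_derivative_compose[OF has_derivative_fst[OF has_derivative_ident]]
        has_deriv_radius_sqr[of t] unfolding has_field_derivative_def t[symmetric] by blast
    then have "(F has_derivative (\<lambda>v. 2 * (snd x \<bullet> snd v) - ?g * fst v)) (at x)"
      unfolding F_def[abs_def]
      by (auto intro!: derivative_eq_intros simp: inner_commute)
    then have "frechet_derivative F (at x) (0, snd x) = 2 * (r t)\<^sup>2"
      by (simp add: frechet_derivative_at[symmetric] n)
    then show ?thesis
      using r_pos[of t] by auto
  qed
  moreover have "\<Sigma> \<inter> U = {x \<in> U. F x = 0}" "p \<in> U"
    using p by (auto simp: mem_\<Sigma> U_def F_def)
  ultimately show "\<exists>U (F :: 'd minkowski \<Rightarrow> real). open U \<and> p \<in> U \<and> smooth_on U F \<and>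
      \<Sigma> \<inter> U = {x \<in> U. F x = 0} \<and> (\<forall>x\<in>\<Sigma> \<inter> U. frechet_derivative F (at x) \<noteq> (\<lambda>v. 0))"
    using F \<open>open U\<close> by blast
qed

section \<open>Tangent and normal vectors\<close>

context
  fixes p :: "'d::finite minkowski" and t :: real
  assumes p: "p \<in> \<Sigma>" and t: "fst p = h t"
begin

lemma snd_p: "snd p \<bullet> snd p = (r t)\<^sup>2"
  using p t by (simp add: mem_\<Sigma>)

lemma profile_velocity_tangent: "(deriv h t, (deriv r t / r t) *\<^sub>R snd p) \<in> tangent_space \<Sigma> p"
proof -
  define c where "c \<tau> = (h (t + \<tau>), (r (t + \<tau>) * inverse (r t)) *\<^sub>R snd p)" for \<tau>
  have shift: "smooth_on UNIV (\<lambda>\<tau>. k (t + \<tau>))" if "smooth_on UNIV k" for k :: "real \<Rightarrow> real"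
    by (rule smooth_on_compose[OF open_UNIV _ that])
      (auto intro!: smooth_on_add smooth_on_const smooth_on_ident)
  have "smooth_on UNIV c"
    unfolding c_def[abs_def]
    by (intro smooth_on_Pair smooth_on_scaleR smooth_on_mult smooth_on_const shift
        smooth_h smooth_r open_UNIV)
  then have "smooth_on {-1<..<1} c"
    using smooth_on_subset by blast
  moreover have "c ` {-1<..<1} \<subseteq> \<Sigma>"
    using r_pos[of t] by (auto simp: c_def mem_\<Sigma> snd_p power2_eq_square field_simps)
  moreover have "c 0 = p"
    using r_pos[of t] t by (simp add: c_def prod_eq_iff)
  moreover have "(c has_vector_derivative (deriv h t, (deriv r t / r t) *\<^sub>R snd p)) (at 0)"
  proof -
    have "((\<lambda>\<tau>. h (t + \<tau>)) has_real_derivative deriv h t) (at 0)"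
      "((\<lambda>\<tau>. r (t + \<tau>)) has_real_derivative deriv r t) (at 0)"
      using DERIV_at_within_shift[of h "deriv h t" t 0 UNIV] DERIV_at_within_shift[of r "deriv r t" t 0 UNIV]
        has_deriv_h has_deriv_r by auto
    then show ?thesis
      unfolding c_def[abs_def]
      by (auto intro!: derivative_eq_intros has_vector_derivative_Pair
          simp: divide_inverse simp flip: has_real_derivative_iff_has_vector_derivative)
  qed
  ultimately show ?thesis
    unfolding tangent_space_def using zero_less_one by blast
qed

text \<open>Normalising \<open>w\<close> to the length of \<open>snd p\<close> makes \<open>cos \<tau> *\<^sub>R snd p + sin \<tau> *\<^sub>R w\<close> a curve on the
  sphere, that is, an actual rotation.\<close>

lemma rotation_velocity_tangent:
  assumes "snd p \<bullet> w = 0" "w \<bullet> w = (r t)\<^sup>2"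
  shows "(0, w) \<in> tangent_space \<Sigma> p"
proof -
  define c where "c \<tau> = (h t, cos \<tau> *\<^sub>R snd p + sin \<tau> *\<^sub>R w)" for \<tau>
  have "smooth_on UNIV c"
    unfolding c_def[abs_def]
    by (intro smooth_on_Pair smooth_on_scaleR smooth_on_add smooth_on_const smooth_on_sin_cos open_UNIV)
  then have "smooth_on {-1<..<1} c"
    using smooth_on_subset by blast
  moreover have "c ` {-1<..<1} \<subseteq> \<Sigma>"
  proof -
    have "(cos \<tau> *\<^sub>R snd p + sin \<tau> *\<^sub>R w) \<bullet> (cos \<tau> *\<^sub>R snd p + sin \<tau> *\<^sub>R w)
        = (r t)\<^sup>2" for \<tau>
    proof -
      have "(cos \<tau> *\<^sub>R snd p + sin \<tau> *\<^sub>R w) \<bullet> (cos \<tau> *\<^sub>R snd p + sin \<tau> *\<^sub>R w)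
          = (cos \<tau>)\<^sup>2 * (snd p \<bullet> snd p) + (sin \<tau>)\<^sup>2 * (w \<bullet> w)"
        by (simp add: inner_simps inner_commute[of w "snd p"] assms(1) power2_eq_square)
      also have "\<dots> = (r t)\<^sup>2 * ((sin \<tau>)\<^sup>2 + (cos \<tau>)\<^sup>2)"
        unfolding snd_p assms(2) by algebra
      finally show ?thesis
        by simp
    qed
    then show ?thesis
      by (intro image_subsetI)
        (simp only: c_def mem_\<Sigma> fst_conv snd_conv radius_sqr_h rangeI simp_thms)
  qed
  moreover have "c 0 = p"
    using t by (simp add: c_def prod_eq_iff)
  moreover have "(c has_vector_derivative (0, w)) (at 0)"
    unfolding c_def[abs_def]
  proof (intro has_vector_derivative_Pair)
    have "(cos has_real_derivative 0) (at (0::real))" "(sin has_real_derivative 1) (at (0::real))"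
      using DERIV_cos[of 0] DERIV_sin[of 0] by simp_all
    from has_vector_derivative_add[OF
        has_vector_derivative_scaleR[OF this(1) has_vector_derivative_const[of "snd p"]]
        has_vector_derivative_scaleR[OF this(2) has_vector_derivative_const[of w]]]
    show "((\<lambda>\<tau>. cos \<tau> *\<^sub>R snd p + sin \<tau> *\<^sub>R w) has_vector_derivative w) (at 0)"
      by simp
  qed simp
  ultimately show ?thesis
    unfolding tangent_space_def using zero_less_one by blast
qed

text \<open>Differentiate \<open>\<bar>snd (c \<tau>)\<bar>\<^sup>2 = radius_sqr (fst (c \<tau>))\<close> along a curve \<open>c\<close> in the hypersurface. The
  resulting equation is orthogonality to the vector \<open>normal\<close> below.\<close>

lemma tangent_equation:
  assumes "w \<in> tangent_space \<Sigma> p"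
  shows "deriv h t * (snd p \<bullet> snd w) = r t * deriv r t * fst w"
proof -
  obtain e c where "e > 0" and c: "c ` {-e<..<e} \<subseteq> \<Sigma>" "c 0 = p"
      "(c has_vector_derivative w) (at 0)"
    using assms unfolding tangent_space_def by blast
  have fst: "((\<lambda>\<tau>. fst (c \<tau>)) has_real_derivative fst w) (at 0)"
    using has_derivative_fst[OF c(3)[unfolded has_vector_derivative_def]]
    by (simp add: has_field_derivative_def mult_commute_abs)
  have "((\<lambda>\<tau>. radius_sqr (fst (c \<tau>))) has_real_derivative
      2 * r t * deriv r t / deriv h t * fst w) (at 0)"
    by (rule DERIV_chain2[OF _ fst]) (simp add: c(2) t has_deriv_radius_sqr)
  then have "((\<lambda>\<tau>. snd (c \<tau>) \<bullet> snd (c \<tau>)) has_real_derivative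
      2 * r t * deriv r t / deriv h t * fst w) (at 0)"
  proof (rule has_field_derivative_transform_within_open[OF _ open_greaterThanLessThan])
    show "0 \<in> {-e<..<e}"
      using \<open>e > 0\<close> by simp
    show "radius_sqr (fst (c \<tau>)) = snd (c \<tau>) \<bullet> snd (c \<tau>)" if "\<tau> \<in> {-e<..<e}" for \<tau>
      using c(1) that mem_\<Sigma> by (metis image_subset_iff)
  qed
  moreover have "((\<lambda>\<tau>. snd (c \<tau>) \<bullet> snd (c \<tau>)) has_real_derivative 2 * (snd p \<bullet> snd w)) (at 0)"
  proof -
    have "((\<lambda>\<tau>. snd (c \<tau>)) has_derivative (\<lambda>\<tau>. \<tau> *\<^sub>R snd w)) (at 0)"
      using has_derivative_snd[OF c(3)[unfolded has_vector_derivative_def]] by simp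
    from has_derivative_inner[OF this this] show ?thesis
      by (simp add: has_field_derivative_def c(2) inner_commute mult_commute_abs
          flip: distrib_left)
  qed
  ultimately have "2 * r t * deriv r t / deriv h t * fst w = 2 * (snd p \<bullet> snd w)"
    by (rule DERIV_unique)
  then show ?thesis
    using deriv_h_nonzero[of t] by (simp add: field_simps)
qed

definition normal :: "'d minkowski" where
  "normal = (r t * deriv r t, deriv h t *\<^sub>R snd p)"

text \<open>Orthogonality to all rotations forces the spatial part of a normal vector to be a multiple
  \<open>\<mu> *\<^sub>R snd p\<close> of the radial direction; orthogonality to the profile curve then determines its time
  component from \<open>\<mu>\<close>, as \<open>h'\<close> does not vanish.\<close>

lemma normal_space_\<Sigma>: "normal_space \<Sigma> p = range (\<lambda>c. c *\<^sub>R normal)"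
proof (intro equalityI subsetI)
  fix v assume "v \<in> range (\<lambda>c. c *\<^sub>R normal)"
  then show "v \<in> normal_space \<Sigma> p"
    using tangent_equation by (auto simp: normal_space_def normal_def eta_inner)
next
  fix v assume v: "v \<in> normal_space \<Sigma> p"
  define \<mu> where "\<mu> = (snd p \<bullet> snd v) / (r t)\<^sup>2"
  (* the component of snd v tangent to the sphere, shown to vanish *)
  define z where "z = snd v - \<mu> *\<^sub>R snd p"
  have pz: "snd p \<bullet> z = 0"
    using r_pos[of t] by (simp add: z_def \<mu>_def inner_diff_right snd_p)
  have z: "z = 0"
  proof (rule ccontr)
    assume "z \<noteq> 0"
    then have "((r t / norm z) *\<^sub>R z) \<bullet> ((r t / norm z) *\<^sub>R z) = (r t)\<^sup>2"
      by (simp add: dot_square_norm power2_eq_square)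
    then have "eta v (0, (r t / norm z) *\<^sub>R z) = 0"
      using v pz rotation_velocity_tangent by (simp add: normal_space_def)
    then have "snd v \<bullet> z = 0"
      using r_pos[of t] \<open>z \<noteq> 0\<close> by (simp add: eta_inner)
    then have "z \<bullet> z = 0"
      using pz by (simp add: z_def inner_diff_left)
    then show False
      using \<open>z \<noteq> 0\<close> by simp
  qed
  have "eta v (deriv h t, (deriv r t / r t) *\<^sub>R snd p) = 0"
    using v profile_velocity_tangent by (simp add: normal_space_def)
  then have "fst v * deriv h t = \<mu> * r t * deriv r t"
    using z r_pos[of t] by (simp add: eta_inner z_def snd_p power2_eq_square mult_ac)
  then have "v = (\<mu> / deriv h t) *\<^sub>R normal"
    using z deriv_h_nonzero[of t] by (simp add: prod_eq_iff normal_def z_def field_simps)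
  then show "v \<in> range (\<lambda>c. c *\<^sub>R normal)"
    by blast
qed

lemma eta_normal: "eta normal normal = (r t)\<^sup>2 * ((\<alpha> t)\<^sup>2 - (deriv \<alpha> t)\<^sup>2)"
  unfolding deriv_h_r_squares[symmetric]
  by (simp add: eta_inner normal_def snd_p power2_eq_square algebra_simps)

lemma normal_nonzero: "normal \<noteq> 0"
proof -
  have "snd p \<noteq> 0"
    using snd_p r_pos[of t] by force
  then show ?thesis
    using deriv_h_nonzero by (simp add: normal_def prod_eq_iff)
qed

text \<open>Rescaling the normal by \<open>c \<noteq> 0\<close> multiplies \<open>eta\<close> by \<open>c\<^sup>2 > 0\<close>, and
  \<open>\<alpha>\<^sup>2 - \<alpha>'\<^sup>2 = (\<alpha> + \<bar>\<alpha>'\<bar>) * (\<alpha> - \<bar>\<alpha>'\<bar>)\<close> has a positive first factor; so only the sign of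
  \<open>\<alpha> - \<bar>\<alpha>'\<bar>\<close> counts.\<close>

lemma normals_causal_character:
  shows "(\<forall>v\<in>normal_space \<Sigma> p - {0}. spacelike v) \<longleftrightarrow> \<alpha> t > \<bar>deriv \<alpha> t\<bar>"
    and "(\<forall>v\<in>normal_space \<Sigma> p - {0}. null v) \<longleftrightarrow> \<alpha> t = \<bar>deriv \<alpha> t\<bar>"
    and "(\<forall>v\<in>normal_space \<Sigma> p - {0}. timelike v) \<longleftrightarrow> \<alpha> t < \<bar>deriv \<alpha> t\<bar>"
proof -
  have line: "(\<forall>v\<in>normal_space \<Sigma> p - {0}. P v) \<longleftrightarrow> (\<forall>c. c \<noteq> 0 \<longrightarrow> P (c *\<^sub>R normal))" for P
    using normal_nonzero by (auto simp: normal_space_\<Sigma>)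
  have eta: "eta (c *\<^sub>R normal) (c *\<^sub>R normal) = (c * r t)\<^sup>2 * ((\<alpha> t)\<^sup>2 - (deriv \<alpha> t)\<^sup>2)" for c
  proof -
    have "eta (c *\<^sub>R normal) (c *\<^sub>R normal) = c\<^sup>2 * eta normal normal"
      by (simp add: eta_inner power2_eq_square algebra_simps)
    then show ?thesis
      by (simp add: eta_normal power_mult_distrib)
  qed
  have sq: "(\<alpha> t)\<^sup>2 - (deriv \<alpha> t)\<^sup>2 = (\<alpha> t + \<bar>deriv \<alpha> t\<bar>) * (\<alpha> t - \<bar>deriv \<alpha> t\<bar>)"
    by (simp add: power2_eq_square algebra_simps)
  have pos: "\<alpha> t + \<bar>deriv \<alpha> t\<bar> > 0" "r t > 0"
    using \<alpha>_pos[of t] r_pos[of t] by auto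
  have scale: "(\<forall>c. c \<noteq> 0 \<longrightarrow> Q c) \<longleftrightarrow> R" if "\<And>c::real. c \<noteq> 0 \<Longrightarrow> Q c \<longleftrightarrow> R" for Q R
    using that zero_neq_one by metis
  show "(\<forall>v\<in>normal_space \<Sigma> p - {0}. spacelike v) \<longleftrightarrow> \<alpha> t > \<bar>deriv \<alpha> t\<bar>"
    unfolding line spacelike_def eta sq
    by (rule scale) (use pos in \<open>simp add: zero_less_mult_iff\<close>)
  show "(\<forall>v\<in>normal_space \<Sigma> p - {0}. null v) \<longleftrightarrow> \<alpha> t = \<bar>deriv \<alpha> t\<bar>"
    unfolding line null_def eta sq
    by (rule scale) (use pos normal_nonzero in simp)
  show "(\<forall>v\<in>normal_space \<Sigma> p - {0}. timelike v) \<longleftrightarrow> \<alpha> t < \<bar>deriv \<alpha> t\<bar>"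
    unfolding line timelike_def eta sq
    by (rule scale) (use pos in \<open>simp add: mult_less_0_iff\<close>)
qed

end

section \<open>Causal character and the null case\<close>

text \<open>Every parameter \<open>t\<close> is attained: the sphere of radius \<open>r t > 0\<close> is nonempty. This is what turns
  conditions at all points into conditions at all \<open>t\<close>.\<close>

lemma ball_\<Sigma>_iff:
  assumes "\<And>p t. p \<in> (\<Sigma> :: 'd::finite minkowski set) \<Longrightarrow> fst p = h t \<Longrightarrow> P p \<longleftrightarrow> Q t"
  shows "(\<forall>p \<in> (\<Sigma> :: 'd minkowski set). P p) \<longleftrightarrow> (\<forall>t. Q t)"
proof -
  have "\<exists>p. p \<in> (\<Sigma> :: 'd minkowski set) \<and> fst p = h t" for t
  proof -
    obtain y :: "real ^ 'd" where "norm y = r t"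
      using vector_choose_size r_pos less_imp_le by blast
    then have "(h t, y) \<in> \<Sigma>"
      by (simp add: mem_\<Sigma> dot_square_norm)
    then show ?thesis by fastforce
  qed
  moreover have "\<exists>t. fst p = h t" if "p \<in> (\<Sigma> :: 'd minkowski set)" for p
    using that mem_\<Sigma> by blast
  ultimately show ?thesis
    using assms by metis
qed

lemma causal_character_\<Sigma>:
  shows "timelike_hypersurface (\<Sigma> :: 'd::finite minkowski set) \<longleftrightarrow> (\<forall>t. \<alpha> t > \<bar>deriv \<alpha> t\<bar>)"
    and "null_hypersurface (\<Sigma> :: 'd minkowski set) \<longleftrightarrow> (\<forall>t. \<alpha> t = \<bar>deriv \<alpha> t\<bar>)"
    and "spacelike_hypersurface (\<Sigma> :: 'd minkowski set) \<longleftrightarrow> (\<forall>t. \<alpha> t < \<bar>deriv \<alpha> t\<bar>)"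
proof -
  let ?S = "\<Sigma> :: 'd minkowski set"
  show "timelike_hypersurface ?S \<longleftrightarrow> (\<forall>t. \<alpha> t > \<bar>deriv \<alpha> t\<bar>)"
    unfolding timelike_hypersurface_def
    by (subst ball_\<Sigma>_iff, rule normals_causal_character(1)) (simp_all add: hypersurface_\<Sigma>)
  show "null_hypersurface ?S \<longleftrightarrow> (\<forall>t. \<alpha> t = \<bar>deriv \<alpha> t\<bar>)"
    unfolding null_hypersurface_def
    by (subst ball_\<Sigma>_iff, rule normals_causal_character(2)) (simp_all add: hypersurface_\<Sigma>)
  show "spacelike_hypersurface ?S \<longleftrightarrow> (\<forall>t. \<alpha> t < \<bar>deriv \<alpha> t\<bar>)"
    unfolding spacelike_hypersurface_def
    by (subst ball_\<Sigma>_iff, rule normals_causal_character(3)) (simp_all add: hypersurface_\<Sigma>)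
qed

end

text \<open>A continuous derivative without zeros has constant sign \<open>\<epsilon>\<close>, which turns the pointwise
  condition into the linear equation \<open>\<alpha>' = \<epsilon> * \<alpha>\<close>.\<close>

lemma abs_deriv_eq_self_iff_exp:
  fixes \<alpha> :: "real \<Rightarrow> real"
  assumes der: "\<And>t. (\<alpha> has_real_derivative deriv \<alpha> t) (at t)"
    and cont: "continuous_on UNIV (deriv \<alpha>)" and pos: "\<And>t. \<alpha> t > 0"
  shows "(\<forall>t. \<alpha> t = \<bar>deriv \<alpha> t\<bar>) \<longleftrightarrow> (\<exists>\<epsilon>\<in>{1, -1}. \<exists>r>0. \<forall>t. \<alpha> t = r * exp (\<epsilon> * t))"
proof
  assume eq: "\<forall>t. \<alpha> t = \<bar>deriv \<alpha> t\<bar>"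
  have "0 \<notin> range (deriv \<alpha>)"
    using eq pos by (metis abs_zero imageE less_irrefl)
  moreover have "connected (range (deriv \<alpha>))"
    using connected_continuous_image[OF cont] by simp
  ultimately have "(\<forall>t. deriv \<alpha> t > 0) \<or> (\<forall>t. deriv \<alpha> t < 0)"
    unfolding connected_iff_interval
    by (meson less_imp_le not_le_imp_less order.not_eq_order_implies_strict rangeI)
  then obtain \<epsilon> where \<epsilon>: "\<epsilon> \<in> {1, -1}" "\<And>t. deriv \<alpha> t = \<epsilon> * \<alpha> t"
  proof
    assume "\<forall>t. deriv \<alpha> t > 0"
    then show thesis using eq that[of 1] by (metis abs_of_pos insertI1 mult_1)
  next
    assume "\<forall>t. deriv \<alpha> t < 0"
    then show thesis using eq that[of "-1"] by (metis abs_of_neg insertCI minus_minus mult_minus1)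
  qed
  have "((\<lambda>t. \<alpha> t * exp (- \<epsilon> * t)) has_real_derivative 0) (at t)" for t
    using der[of t] unfolding \<epsilon>(2) by (auto intro!: derivative_eq_intros)
  then have "\<alpha> t * exp (- \<epsilon> * t) = \<alpha> 0" for t
    using DERIV_isconst_all[of "\<lambda>t. \<alpha> t * exp (- \<epsilon> * t)" t 0] by simp
  then have "\<alpha> t / exp (\<epsilon> * t) = \<alpha> 0" for t
    by (simp add: exp_minus divide_inverse)
  then have "\<alpha> t = \<alpha> 0 * exp (\<epsilon> * t)" for t
    by (metis exp_not_eq_zero nonzero_divide_eq_eq)
  then show "\<exists>\<epsilon>\<in>{1, -1}. \<exists>r>0. \<forall>t. \<alpha> t = r * exp (\<epsilon> * t)"
    using \<epsilon>(1) pos[of 0] by blast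
next
  assume "\<exists>\<epsilon>\<in>{1, -1}. \<exists>r>0. \<forall>t. \<alpha> t = r * exp (\<epsilon> * t)"
  then obtain \<epsilon> r where *: "\<epsilon> \<in> {1, -1}" "r > 0" "\<And>t. \<alpha> t = r * exp (\<epsilon> * t)"
    by blast
  have "deriv \<alpha> t = \<epsilon> * \<alpha> t" for t
  proof (rule DERIV_imp_deriv)
    have "((\<lambda>t. r * exp (\<epsilon> * t)) has_real_derivative \<epsilon> * (r * exp (\<epsilon> * t))) (at t)"
      by (auto intro!: derivative_eq_intros)
    then show "(\<alpha> has_real_derivative \<epsilon> * \<alpha> t) (at t)"
      by (simp add: *(3)[abs_def] fun_eq_iff)
  qed
  then show "\<forall>t. \<alpha> t = \<bar>deriv \<alpha> t\<bar>"
    using *(1) pos by (auto simp: abs_mult less_imp_le)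
qed

theorem corollary3p8:
  fixes n :: nat and \<alpha> :: "real \<Rightarrow> real" and \<Sigma> :: "'d::finite minkowski set"
  assumes "n \<ge> 1" and "CARD('d) = n + 1"
    and "\<alpha> \<in> Psi"
    and "\<Sigma> = dS (range (h_of \<alpha>)) (f_of \<alpha>)"
  shows "(timelike_hypersurface \<Sigma> \<longleftrightarrow> (\<forall>t. \<alpha> t > \<bar>deriv \<alpha> t\<bar>)) \<and>
    (null_hypersurface \<Sigma> \<longleftrightarrow>
      (\<exists>\<epsilon>\<in>{1, -1}. \<exists>r>0. \<forall>t. \<alpha> t = r * exp (\<epsilon> * t))) \<and>
    (spacelike_hypersurface \<Sigma> \<longleftrightarrow> (\<forall>t. \<alpha> t < \<bar>deriv \<alpha> t\<bar>))"
proof -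
  interpret psi_profile \<alpha>
    by unfold_locales (rule assms(3))
  have "smooth_on UNIV (deriv \<alpha>)"
    using smooth_on_deriv(2)[OF open_UNIV smooth_\<alpha>] .
  then have "continuous_on UNIV (deriv \<alpha>)"
    unfolding smooth_on_def using Ck_on.simps(1) by blast
  then have "(\<forall>t. \<alpha> t = \<bar>deriv \<alpha> t\<bar>) \<longleftrightarrow> (\<exists>\<epsilon>\<in>{1, -1}. \<exists>r>0. \<forall>t. \<alpha> t = r * exp (\<epsilon> * t))"
    by (rule abs_deriv_eq_self_iff_exp[OF deriv_\<alpha> _ \<alpha>_pos])
  then show ?thesis
    unfolding assms(4) causal_character_\<Sigma> by blast
qed

end
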